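(* Let $v \ge 3$ and $k \ge 2$ be integers with $v \equiv 1 \pmod k$ such that there exists a Frobenius group $K \rtimes H$ with $|K| = v$ and $H$ containing an element $\phi$ of order $k$. Then a $(p(k)-1)$-fold perfect $(v,k,1)$-RMD exists and can be constructed based on $K$. Moreover, this $(v,k,1)$-RMD admits $K \rtimes \langle \phi \rangle$ as a group of automorphisms. In particular, if $k$ is a prime, then it is a $(v,k,1)$-RPMD. Furthermore, the $(v,k,1)$-RMDs constructed by using conjugate elements of $H$ with order $k$ are isomorphic to each other.
   Context: All sets and groups are finite. For an integer $k\ge 2$, $p(k)$ denotes the smallest prime factor of $k$. Mendelsohn designs. For integers $v\ge k\ge 2$, a $(v,k,1)$-Mendelsohn design, or $(v,k,1)$-MD, is a set $X$ of $v$ points together with a collection $\mathcal{B}$ of cyclically ordered $k$-subsets of $X$ (blocks) such that every ordered pair of distinct points is consecutive in exactly one block. In a block $(a_1,\dots,a_k)$ (cyclic order $a_1<a_2<\dots<a_k<a_1$), $a_i$ and $a_{i+t}$ are said to be $t$-apart (subscripts modulo $k$); consecutive means $1$-apart. The design is $\ell$-fold perfect if for each $t=1,\dots,\ell$ every ordered pair of distinct points appears $t$-apart in exactly one block, and perfect if it is $(k-1)$-fold perfect. It is resolvable (a $(v,k,1)$-RMD) if either $v\equiv 0 \pmod k$ and the blocks can be partitioned into $v-1$ parts each consisting of $v/k$ pairwise disjoint blocks, or $v\equiv 1\pmod k$ and the blocks can be partitioned into $v$ parts each consisting of $(v-1)/k$ pairwise disjoint blocks. A $(v,k,1)$-RPMD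 is a resolvable perfect $(v,k,1)$-MD. An MD $(X,\mathcal{B})$ admits a group $G$ as a group of automorphisms if $G$ acts (not necessarily faithfully) on $X$ and preserves the block set $\mathcal{B}$. It is based on $G$ if $X$ can be identified with $G$ in such a way that the MD admits the left regular representation of $G$ (the group of permutations $x\mapsto gx$, $g\in G$) as a group of automorphisms. Two MDs are isomorphic if there is a bijection between their point sets that maps the cyclically ordered blocks of one exactly onto those of the other. Frobenius groups. If a group $H$ acts on a group $K$ by group automorphisms and $H$ is semiregular on $K\setminus\{1\}$ (that is, $h(x)=x$ with $h\in H$, $x\in K\setminus\{1\}$ implies $h=1_H$), then the semidirect product $K\rtimes H$ with respect to this action is called a Frobenius group, with kernel $K$ and complement $H$. For $\phi\in H$, $\langle\phi\rangle$ is the cyclic subgroup generated by $\phi$. Meaning of "constructed by using" an element. The $(v,k,1)$-RMD constructed by using an element $\phi\in H$ of order $k$ has point set $K$, and its blocks are the cyclically ordered sets $(gx,\,g\phi(x),\,g\phi^2(x),\dots,g\phi^{k-1}(x))$, where $g$ runs over $K$ and $x$ runs over a set of representatives of the $\langle\phi\rangle$-orbits on $K\setminus\{1\}$. *)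

theory Defs
  imports "HOL-Algebra.Group_Action" "HOL-Algebra.Multiplicative_Group"
    "HOL-Algebra.Generated_Groups" "HOL-Library.Disjoint_Sets" "HOL-Computational_Algebra.Primes"
begin

section \<open>Mendelsohn designs\<close>

text \<open>
  The cyclically ordered set \<open>(a\<^sub>1, \<dots>, a\<^sub>k)\<close> is the class of the distinct list
  \<open>[a\<^sub>1, \<dots>, a\<^sub>k]\<close> under rotation.
\<close>

definition cyc :: "'a list \<Rightarrow> 'a list set" where
  "cyc xs = {rotate n xs | n. True}"

definition cyclic_subsets :: "nat \<Rightarrow> 'a set \<Rightarrow> 'a list set set" where
  "cyclic_subsets k X = {cyc xs | xs. distinct xs \<and> length xs = k \<and> set xs \<subseteq> X}"

definition points_of :: "'a list set \<Rightarrow> 'a set" where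
  "points_of b = (\<Union>xs\<in>b. set xs)"

definition t_apart :: "nat \<Rightarrow> 'a list set \<Rightarrow> 'a \<Rightarrow> 'a \<Rightarrow> bool" where
  "t_apart t b x y \<longleftrightarrow>
     (\<exists>xs\<in>b. \<exists>i<length xs. x = xs ! i \<and> y = xs ! ((i + t) mod length xs))"

definition map_block :: "('a \<Rightarrow> 'b) \<Rightarrow> 'a list set \<Rightarrow> 'b list set" where
  "map_block f b = map f ` b"

definition each_pair_once_apart :: "nat \<Rightarrow> 'a set \<Rightarrow> 'a list set set \<Rightarrow> bool" where
  "each_pair_once_apart t X B \<longleftrightarrow>
     (\<forall>x\<in>X. \<forall>y\<in>X. x \<noteq> y \<longrightarrow> (\<exists>!b. b \<in> B \<and> t_apart t b x y))"

text \<open>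
  No block can be repeated in a Mendelsohn design (some ordered pair would be consecutive in two
  blocks), so the collection of blocks is a set.
\<close>

definition mendelsohn_design :: "nat \<Rightarrow> nat \<Rightarrow> 'a set \<Rightarrow> 'a list set set \<Rightarrow> bool" where
  "mendelsohn_design v k X B \<longleftrightarrow>
     2 \<le> k \<and> k \<le> v \<and> finite X \<and> card X = v \<and> B \<subseteq> cyclic_subsets k X \<and>
     each_pair_once_apart 1 X B"

definition fold_perfect :: "nat \<Rightarrow> 'a set \<Rightarrow> 'a list set set \<Rightarrow> bool" where
  "fold_perfect l X B \<longleftrightarrow> (\<forall>t\<in>{1..l}. each_pair_once_apart t X B)"

definition pairwise_disjoint_blocks :: "'a list set set \<Rightarrow> bool" where
  "pairwise_disjoint_blocks P \<longleftrightarrow> pairwise (\<lambda>b c. disjnt (points_of b) (points_of c)) P"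

definition resolvable :: "nat \<Rightarrow> nat \<Rightarrow> 'a list set set \<Rightarrow> bool" where
  "resolvable v k B \<longleftrightarrow>
     (v mod k = 0 \<and>
       (\<exists>\<P>. partition_on B \<P> \<and> card \<P> = v - 1 \<and>
         (\<forall>P\<in>\<P>. card P = v div k \<and> pairwise_disjoint_blocks P))) \<or>
     (v mod k = 1 \<and>
       (\<exists>\<P>. partition_on B \<P> \<and> card \<P> = v \<and>
         (\<forall>P\<in>\<P>. card P = (v - 1) div k \<and> pairwise_disjoint_blocks P)))"

definition RMD :: "nat \<Rightarrow> nat \<Rightarrow> 'a set \<Rightarrow> 'a list set set \<Rightarrow> bool" where
  "RMD v k X B \<longleftrightarrow> mendelsohn_design v k X B \<and> resolvable v k B"

definition RPMD :: "nat \<Rightarrow> nat \<Rightarrow> 'a set \<Rightarrow> 'a list set set \<Rightarrow> bool" where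
  "RPMD v k X B \<longleftrightarrow> RMD v k X B \<and> fold_perfect (k - 1) X B"

definition MD_isomorphic ::
  "'a set \<Rightarrow> 'a list set set \<Rightarrow> 'b set \<Rightarrow> 'b list set set \<Rightarrow> bool" where
  "MD_isomorphic X B Y C \<longleftrightarrow> (\<exists>f. bij_betw f X Y \<and> map_block f ` B = C)"

text \<open>The action \<open>\<alpha>\<close> is kept explicit: for some action (the trivial one) the condition is void.\<close>

definition admits_automorphisms ::
  "('g, 'm) monoid_scheme \<Rightarrow> ('g \<Rightarrow> 'a \<Rightarrow> 'a) \<Rightarrow> 'a set \<Rightarrow> 'a list set set \<Rightarrow> bool" where
  "admits_automorphisms G \<alpha> X B \<longleftrightarrow>
     group_action G X \<alpha> \<and> (\<forall>g\<in>carrier G. map_block (\<alpha> g) ` B = B)"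

definition left_regular :: "('g, 'm) monoid_scheme \<Rightarrow> 'g \<Rightarrow> 'g \<Rightarrow> 'g" where
  "left_regular G g = (\<lambda>x\<in>carrier G. g \<otimes>\<^bsub>G\<^esub> x)"

definition based_on :: "('g, 'm) monoid_scheme \<Rightarrow> 'a set \<Rightarrow> 'a list set set \<Rightarrow> bool" where
  "based_on G X B \<longleftrightarrow>
     (\<exists>f. bij_betw f X (carrier G) \<and>
       admits_automorphisms G (left_regular G) (carrier G) (map_block f ` B))"

section \<open>Frobenius groups\<close>

definition semidirect_product ::
  "('a, 'm) monoid_scheme \<Rightarrow> ('h, 'n) monoid_scheme \<Rightarrow> ('h \<Rightarrow> 'a \<Rightarrow> 'a) \<Rightarrow> ('a \<times> 'h) monoid" where
  "semidirect_product K H \<theta> =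
     \<lparr>carrier = carrier K \<times> carrier H,
      monoid.mult = \<lambda>(x, h) (y, h'). (x \<otimes>\<^bsub>K\<^esub> \<theta> h y, h \<otimes>\<^bsub>H\<^esub> h'),
      one = (\<one>\<^bsub>K\<^esub>, \<one>\<^bsub>H\<^esub>)\<rparr>"

text \<open>
  The (finite) group \<open>semidirect_product K H \<theta>\<close> is a Frobenius group with kernel \<open>K\<close> and
  complement \<open>H\<close>, where \<open>h\<close> in \<open>H\<close> acts on \<open>K\<close> as the automorphism \<open>\<theta> h\<close>.
\<close>

definition frobenius_group ::
  "('a, 'm) monoid_scheme \<Rightarrow> ('h, 'n) monoid_scheme \<Rightarrow> ('h \<Rightarrow> 'a \<Rightarrow> 'a) \<Rightarrow> bool" where
  "frobenius_group K H \<theta> \<longleftrightarrow>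
     group K \<and> group H \<and> finite (carrier K) \<and> finite (carrier H) \<and>
     \<theta> \<in> hom H (AutoGroup K) \<and>
     (\<forall>h\<in>carrier H. \<forall>x\<in>carrier K - {\<one>\<^bsub>K\<^esub>}. \<theta> h x = x \<longrightarrow> h = \<one>\<^bsub>H\<^esub>)"

text \<open>The action of the semidirect product on its kernel: \<open>K\<close> by left translation, \<open>H\<close> via \<open>\<theta>\<close>.\<close>

definition kernel_action ::
  "('a, 'm) monoid_scheme \<Rightarrow> ('h \<Rightarrow> 'a \<Rightarrow> 'a) \<Rightarrow> 'a \<times> 'h \<Rightarrow> 'a \<Rightarrow> 'a" where
  "kernel_action K \<theta> = (\<lambda>(g, h). \<lambda>x\<in>carrier K. g \<otimes>\<^bsub>K\<^esub> \<theta> h x)"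

abbreviation cyclic_subgroup :: "('h, 'n) monoid_scheme \<Rightarrow> 'h \<Rightarrow> ('h, 'n) monoid_scheme" where
  "cyclic_subgroup H \<phi> \<equiv> subgroup_generated H {\<phi>}"

definition conjugate_in :: "('h, 'n) monoid_scheme \<Rightarrow> 'h \<Rightarrow> 'h \<Rightarrow> bool" where
  "conjugate_in H a b \<longleftrightarrow> (\<exists>h\<in>carrier H. b = h \<otimes>\<^bsub>H\<^esub> a \<otimes>\<^bsub>H\<^esub> inv\<^bsub>H\<^esub> h)"

section \<open>The construction from an element of the complement\<close>

definition orbit_representatives ::
  "('a, 'm) monoid_scheme \<Rightarrow> ('h, 'n) monoid_scheme \<Rightarrow> ('h \<Rightarrow> 'a \<Rightarrow> 'a) \<Rightarrow> 'h \<Rightarrow> 'a set \<Rightarrow> bool" where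
  "orbit_representatives K H \<theta> \<phi> R \<longleftrightarrow>
     R \<subseteq> carrier K - {\<one>\<^bsub>K\<^esub>} \<and>
     (\<forall>S\<in>orbits (cyclic_subgroup H \<phi>) (carrier K - {\<one>\<^bsub>K\<^esub>}) \<theta>. \<exists>!x. x \<in> R \<inter> S)"

definition constructed_blocks ::
  "('a, 'm) monoid_scheme \<Rightarrow> ('h, 'n) monoid_scheme \<Rightarrow> ('h \<Rightarrow> 'a \<Rightarrow> 'a) \<Rightarrow> 'h \<Rightarrow> 'a set
     \<Rightarrow> 'a list set set" where
  "constructed_blocks K H \<theta> \<phi> R =
     {cyc (map (\<lambda>i. g \<otimes>\<^bsub>K\<^esub> \<theta> (\<phi> [^]\<^bsub>H\<^esub> i) x) [0..<group.ord H \<phi>]) | g x.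
        g \<in> carrier K \<and> x \<in> R}"

definition smallest_prime_factor :: "nat \<Rightarrow> nat" where
  "smallest_prime_factor k = Min (prime_factors k)"

end

theory Submission
  imports Defs
begin

text \<open>
  Write \<open>\<sigma> = \<theta> \<phi>\<close>, so that \<open>\<sigma>\<^sup>t = \<theta> (\<phi>\<^sup>t)\<close> (\<open>\<sigma> t\<close> below). For \<open>0 < t < k\<close> this automorphism has no fixed
  point except the identity, and therefore the displacement map \<open>w \<mapsto> w\<inverse> \<cdot> \<sigma>\<^sup>t w\<close> is injective on the
  finite group \<open>K\<close>, hence bijective (\<open>displacement_bij\<close>). If \<open>a = g \<cdot> z\<close> and \<open>b = g \<cdot> \<sigma>\<^sup>t z\<close>, then
  \<open>a\<inverse> \<cdot> b\<close> is the displacement of \<open>z\<close>; so every ordered pair of distinct points has exactly one such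
  description \<open>(g, z)\<close> with \<open>z \<noteq> 1\<close> (\<open>ordered_pair_decomposition\<close> and its uniqueness counterpart).

  A block is the left translate by \<open>g\<close> of the \<open>\<sigma>\<close>-orbit of some \<open>x\<close>, and starting the orbit at
  another point \<open>\<sigma>\<^sup>i x\<close> only rotates the list. Hence the set of blocks does not depend on the
  representatives: it consists of the blocks of all pairs \<open>(g, x)\<close> with \<open>x \<noteq> 1\<close>
  (\<open>constructed_blocks_eq_all\<close>). The decomposition of pairs now says that every ordered pair occurs
  \<open>t\<close>-apart in exactly one block for each \<open>0 < t < k\<close>. This yields the Mendelsohn design
  (\<open>t = 1\<close>) and its perfectness up to \<open>p(k) - 1 \<le> k - 1\<close>. The blocks with a fixed \<open>g\<close> cut
  \<open>K - {g}\<close> into translated orbits and form one parallel class, and the uniqueness for \<open>t = 1\<close>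
  keeps the classes of different \<open>g\<close> apart.

  Because the description of the block set is free of representatives, symmetry is immediate. A left
  translation acts on the factor \<open>g\<close>, a power of \<open>\<phi>\<close> acts on both \<open>g\<close> and \<open>x\<close>, and when
  \<open>\<psi>' = h \<psi> h\<inverse>\<close> the automorphism \<open>\<theta> h\<close> carries the block of \<open>(g, x)\<close> for \<open>\<psi>\<close> to the block of
  \<open>(\<theta> h g, \<theta> h x)\<close> for \<open>\<psi>'\<close>.
\<close>

section \<open>Cyclically ordered sets\<close>

lemma cyc_rotate: "cyc (rotate m xs) = cyc xs"
proof
  show "cyc (rotate m xs) \<subseteq> cyc xs"
    unfolding cyc_def by (auto simp: rotate_rotate)
  show "cyc xs \<subseteq> cyc (rotate m xs)"
  proof
    fix ys assume "ys \<in> cyc xs"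
    then obtain n where n: "ys = rotate n xs" by (auto simp: cyc_def)
    \<comment> \<open>Rotating back by \<open>m\<close> is rotating forward by \<open>m\<close> times one less than the length.\<close>
    have "rotate n xs = rotate (n + m * length xs) xs"
      by (subst (1 2) rotate_conv_mod) simp
    also have "\<dots> = rotate (n + m * (length xs - 1) + m) xs"
      by (cases xs) (simp_all add: ac_simps)
    also have "\<dots> = rotate (n + m * (length xs - 1)) (rotate m xs)" by (simp add: rotate_rotate)
    finally show "ys \<in> cyc (rotate m xs)" using n by (auto simp: cyc_def)
  qed
qed

lemma map_block_cyc: "map_block f (cyc xs) = cyc (map f xs)"
  by (auto simp: map_block_def cyc_def rotate_map)

lemma points_of_cyc: "points_of (cyc xs) = set xs"
  by (auto simp: points_of_def cyc_def)

text \<open>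
  A rotation shifts both positions by the same amount modulo the length, so it is enough to inspect
  one list of the cyclic class.
\<close>

lemma t_apart_cyc:
  "t_apart t (cyc xs) x y \<longleftrightarrow>
     (\<exists>i<length xs. x = xs ! i \<and> y = xs ! ((i + t) mod length xs))"
proof
  assume "t_apart t (cyc xs) x y"
  then obtain n i where i: "i < length xs" and x: "x = rotate n xs ! i"
    and y: "y = rotate n xs ! ((i + t) mod length xs)"
    by (auto simp: t_apart_def cyc_def)
  have pos: "length xs > 0" using i by linarith
  have "x = xs ! ((n + i) mod length xs)"
    using x i by (simp add: nth_rotate)
  moreover have "y = xs ! (((n + i) mod length xs + t) mod length xs)"
    using y pos by (simp add: nth_rotate mod_simps add.assoc)
  ultimately show "\<exists>i<length xs. x = xs ! i \<and> y = xs ! ((i + t) mod length xs)"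
    using pos by (intro exI[of _ "(n + i) mod length xs"]) auto
next
  assume "\<exists>i<length xs. x = xs ! i \<and> y = xs ! ((i + t) mod length xs)"
  moreover have "xs \<in> cyc xs" by (auto simp: cyc_def intro: exI[of _ 0])
  ultimately show "t_apart t (cyc xs) x y" unfolding t_apart_def by blast
qed

section \<open>Actions by automorphisms and the semidirect product\<close>

text \<open>
  The group that acts is kept arbitrary, so that the semidirect product with \<open>\<langle>\<phi>\<rangle>\<close> arises by
  instantiating it with a cyclic subgroup of the complement.
\<close>

locale automorphism_action = K: group K + H: group H
  for K :: "('a, 'm) monoid_scheme" and H :: "('h, 'n) monoid_scheme" +
  fixes \<theta> :: "'h \<Rightarrow> 'a \<Rightarrow> 'a"
  assumes action_hom: "\<theta> \<in> hom H (AutoGroup K)"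
begin

abbreviation times_K (infixl "\<cdot>" 70) where "x \<cdot> y \<equiv> x \<otimes>\<^bsub>K\<^esub> y"

abbreviation nonunits where "nonunits \<equiv> carrier K - {\<one>\<^bsub>K\<^esub>}"

lemma action_auto: "h \<in> carrier H \<Longrightarrow> \<theta> h \<in> auto K"
  using action_hom by (auto simp: hom_def AutoGroup_def)

lemma action_bij: "h \<in> carrier H \<Longrightarrow> bij_betw (\<theta> h) (carrier K) (carrier K)"
  using action_auto by (auto simp: auto_def Bij_def)

lemma action_group_hom: "h \<in> carrier H \<Longrightarrow> group_hom K K (\<theta> h)"
  using action_auto by (auto simp: auto_def group_hom_def group_hom_axioms_def K.is_group)

lemma action_closed [simp]: "h \<in> carrier H \<Longrightarrow> x \<in> carrier K \<Longrightarrow> \<theta> h x \<in> carrier K"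
  using action_bij by (auto simp: bij_betw_def)

lemma action_mult:
  "h \<in> carrier H \<Longrightarrow> x \<in> carrier K \<Longrightarrow> y \<in> carrier K \<Longrightarrow> \<theta> h (x \<cdot> y) = \<theta> h x \<cdot> \<theta> h y"
  using action_group_hom group_hom.hom_mult by fastforce

lemma action_inv:
  "h \<in> carrier H \<Longrightarrow> x \<in> carrier K \<Longrightarrow> \<theta> h (inv\<^bsub>K\<^esub> x) = inv\<^bsub>K\<^esub> (\<theta> h x)"
  using action_group_hom group_hom.hom_inv by fastforce

lemma action_unit [simp]: "h \<in> carrier H \<Longrightarrow> \<theta> h \<one>\<^bsub>K\<^esub> = \<one>\<^bsub>K\<^esub>"
  using action_group_hom group_hom.hom_one by fastforce

lemma action_comp:
  assumes "g \<in> carrier H" "h \<in> carrier H" "x \<in> carrier K"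
  shows "\<theta> (g \<otimes>\<^bsub>H\<^esub> h) x = \<theta> g (\<theta> h x)"
proof -
  have "\<theta> (g \<otimes>\<^bsub>H\<^esub> h) = \<theta> g \<otimes>\<^bsub>AutoGroup K\<^esub> \<theta> h"
    using action_hom assms by (simp add: hom_mult)
  then show ?thesis
    using action_auto assms by (auto simp: AutoGroup_def BijGroup_def auto_def compose_def)
qed

lemma action_one [simp]: "x \<in> carrier K \<Longrightarrow> \<theta> \<one>\<^bsub>H\<^esub> x = x"
proof -
  assume x: "x \<in> carrier K"
  have "\<theta> \<one>\<^bsub>H\<^esub> (\<theta> \<one>\<^bsub>H\<^esub> x) = \<theta> \<one>\<^bsub>H\<^esub> x"
    using action_comp[of "\<one>\<^bsub>H\<^esub>" "\<one>\<^bsub>H\<^esub>" x] x by simp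
  then show ?thesis
    using action_bij[of "\<one>\<^bsub>H\<^esub>"] x by (auto simp: bij_betw_def inj_on_def)
qed

lemma action_eq_iff:
  "h \<in> carrier H \<Longrightarrow> x \<in> carrier K \<Longrightarrow> y \<in> carrier K \<Longrightarrow> \<theta> h x = \<theta> h y \<longleftrightarrow> x = y"
  using action_bij by (auto simp: bij_betw_def inj_on_def)

lemma action_nonunits: "h \<in> carrier H \<Longrightarrow> x \<in> nonunits \<Longrightarrow> \<theta> h x \<in> nonunits"
  using action_eq_iff[of h x "\<one>\<^bsub>K\<^esub>"] by auto

lemma semidirect_group: "group (semidirect_product K H \<theta>)"
proof (rule groupI)
  fix p assume "p \<in> carrier (semidirect_product K H \<theta>)"
  then obtain x h where p: "p = (x, h)" and x: "x \<in> carrier K" and h: "h \<in> carrier H"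
    by (auto simp: semidirect_product_def)
  show "\<exists>q\<in>carrier (semidirect_product K H \<theta>).
      q \<otimes>\<^bsub>semidirect_product K H \<theta>\<^esub> p = \<one>\<^bsub>semidirect_product K H \<theta>\<^esub>"
    \<comment> \<open>The inverse solves \<open>y \<cdot> \<theta> (h\<inverse>) x = 1\<close>, so \<open>y = \<theta> (h\<inverse>) (x\<inverse>)\<close>.\<close>
    using p x h
    by (intro bexI[of _ "(\<theta> (inv\<^bsub>H\<^esub> h) (inv\<^bsub>K\<^esub> x), inv\<^bsub>H\<^esub> h)"])
      (auto simp: semidirect_product_def simp flip: action_mult)
qed (auto simp: semidirect_product_def action_mult action_comp K.m_assoc H.m_assoc)

text \<open>The affine map is an automorphism followed by a left translation, both of them bijective.\<close>

lemma kernel_action_bij: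
  assumes "g \<in> carrier K" "h \<in> carrier H"
  shows "kernel_action K \<theta> (g, h) \<in> Bij (carrier K)"
proof -
  have "bij_betw (\<lambda>x. g \<cdot> x) (carrier K) (carrier K)"
    using assms(1) by (auto simp: bij_betw_def inj_on_def K.surj_const_mult)
  then have "bij_betw ((\<lambda>x. g \<cdot> x) \<circ> \<theta> h) (carrier K) (carrier K)"
    using action_bij[OF assms(2)] by (rule bij_betw_trans[rotated])
  then have "bij_betw (kernel_action K \<theta> (g, h)) (carrier K) (carrier K)"
    by (rule bij_betw_cong[THEN iffD1, rotated]) (auto simp: kernel_action_def)
  then show ?thesis by (auto simp: Bij_def kernel_action_def)
qed

lemma kernel_action_group_action:
  "group_action (semidirect_product K H \<theta>) (carrier K) (kernel_action K \<theta>)"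
proof -
  let ?S = "semidirect_product K H \<theta>"
  have "kernel_action K \<theta> (p \<otimes>\<^bsub>?S\<^esub> q)
      = kernel_action K \<theta> p \<otimes>\<^bsub>BijGroup (carrier K)\<^esub> kernel_action K \<theta> q"
    if "p \<in> carrier ?S" "q \<in> carrier ?S" for p q
  proof -
    obtain x h y j where pq: "p = (x, h)" "q = (y, j)"
      and c: "x \<in> carrier K" "h \<in> carrier H" "y \<in> carrier K" "j \<in> carrier H"
      using \<open>p \<in> carrier ?S\<close> \<open>q \<in> carrier ?S\<close> by (auto simp: semidirect_product_def)
    have "kernel_action K \<theta> (p \<otimes>\<^bsub>?S\<^esub> q)
        = compose (carrier K) (kernel_action K \<theta> p) (kernel_action K \<theta> q)"
      using c unfolding pq
      by (auto simp: semidirect_product_def kernel_action_def compose_def fun_eq_iff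
          action_mult action_comp K.m_assoc)
    also have "\<dots> = kernel_action K \<theta> p \<otimes>\<^bsub>BijGroup (carrier K)\<^esub> kernel_action K \<theta> q"
      using kernel_action_bij c unfolding pq by (simp add: BijGroup_def)
    finally show ?thesis .
  qed
  moreover have "kernel_action K \<theta> p \<in> carrier (BijGroup (carrier K))" if "p \<in> carrier ?S" for p
    using kernel_action_bij that by (auto simp: semidirect_product_def BijGroup_def)
  ultimately show ?thesis
    unfolding group_action_def group_hom_def group_hom_axioms_def
    by (auto simp: semidirect_group group_BijGroup hom_def)
qed

end

section \<open>Fixed-point-free automorphisms\<close>

locale frobenius = automorphism_action K H \<theta>
  for K :: "('a, 'm) monoid_scheme" and H :: "('h, 'n) monoid_scheme"
    and \<theta> :: "'h \<Rightarrow> 'a \<Rightarrow> 'a" +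
  assumes finite_K: "finite (carrier K)" and finite_H: "finite (carrier H)"
    and fixed_point_free:
      "\<And>h x. h \<in> carrier H \<Longrightarrow> x \<in> carrier K - {\<one>\<^bsub>K\<^esub>} \<Longrightarrow> \<theta> h x = x \<Longrightarrow> h = \<one>\<^bsub>H\<^esub>"

lemma frobenius_iff: "frobenius K H \<theta> \<longleftrightarrow> frobenius_group K H \<theta>"
  by (auto simp: frobenius_def frobenius_group_def frobenius_axioms_def
      automorphism_action_def automorphism_action_axioms_def)

context frobenius
begin

lemma semiregular:
  assumes "g \<in> carrier H" "h \<in> carrier H" "x \<in> nonunits" "\<theta> g x = \<theta> h x"
  shows "g = h"
proof -
  have "\<theta> (inv\<^bsub>H\<^esub> h \<otimes>\<^bsub>H\<^esub> g) x = \<theta> (inv\<^bsub>H\<^esub> h \<otimes>\<^bsub>H\<^esub> h) x"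
    using assms by (simp only: action_comp H.inv_closed Diff_iff)
  then have "inv\<^bsub>H\<^esub> h \<otimes>\<^bsub>H\<^esub> g = \<one>\<^bsub>H\<^esub>"
    using assms by (intro fixed_point_free[of _ x]) auto
  then show ?thesis using assms by (metis H.inv_closed H.inv_inv H.inv_equality)
qed

text \<open>
  Two elements \<open>w\<close> and \<open>u\<close> with equal displacement make \<open>u \<cdot> w\<inverse>\<close> a fixed point of \<open>\<theta> h\<close>, so
  \<open>u = w\<close>; an injective self-map of a finite set is onto.
\<close>

lemma displacement_bij:
  assumes h: "h \<in> carrier H" "h \<noteq> \<one>\<^bsub>H\<^esub>"
  shows "bij_betw (\<lambda>w. inv\<^bsub>K\<^esub> w \<cdot> \<theta> h w) (carrier K) (carrier K)"
proof -
  have "inj_on (\<lambda>w. inv\<^bsub>K\<^esub> w \<cdot> \<theta> h w) (carrier K)"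
  proof (rule inj_onI)
    fix w u assume w: "w \<in> carrier K" and u: "u \<in> carrier K"
      and eq: "inv\<^bsub>K\<^esub> w \<cdot> \<theta> h w = inv\<^bsub>K\<^esub> u \<cdot> \<theta> h u"
    have "u \<cdot> inv\<^bsub>K\<^esub> w \<cdot> \<theta> h w = u \<cdot> (inv\<^bsub>K\<^esub> u \<cdot> \<theta> h u)"
      using w u h by (simp add: K.m_assoc eq)
    also have "\<dots> = \<theta> h u" using u h by (simp flip: K.m_assoc)
    finally have "\<theta> h (u \<cdot> inv\<^bsub>K\<^esub> w) = u \<cdot> inv\<^bsub>K\<^esub> w"
      using w u h by (simp add: action_mult action_inv K.inv_solve_right')
    then have "u \<cdot> inv\<^bsub>K\<^esub> w = \<one>\<^bsub>K\<^esub>"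
      using fixed_point_free[of h "u \<cdot> inv\<^bsub>K\<^esub> w"] w u h by auto
    then show "w = u" using w u by (metis K.inv_closed K.inv_equality K.inv_inv)
  qed
  moreover have "(\<lambda>w. inv\<^bsub>K\<^esub> w \<cdot> \<theta> h w) ` carrier K \<subseteq> carrier K" using h by auto
  ultimately show ?thesis
    using finite_K by (simp add: bij_betw_def endo_inj_surj)
qed

text \<open>
  The element \<open>z\<close> must have displacement \<open>a\<inverse> \<cdot> b\<close>, which is attainable, and then \<open>g = a \<cdot> z\<inverse>\<close>.
  It is not the identity since the displacement is not.
\<close>

lemma ordered_pair_decomposition:
  assumes h: "h \<in> carrier H" "h \<noteq> \<one>\<^bsub>H\<^esub>"
    and ab: "a \<in> carrier K" "b \<in> carrier K" "a \<noteq> b"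
  shows "\<exists>g\<in>carrier K. \<exists>z\<in>nonunits. a = g \<cdot> z \<and> b = g \<cdot> \<theta> h z"
proof -
  obtain z where z: "z \<in> carrier K" and eq: "inv\<^bsub>K\<^esub> z \<cdot> \<theta> h z = inv\<^bsub>K\<^esub> a \<cdot> b"
    using displacement_bij[OF h] ab unfolding bij_betw_def
    by (metis (no_types, lifting) K.inv_closed K.m_closed imageE)
  have "a \<cdot> inv\<^bsub>K\<^esub> z \<cdot> \<theta> h z = a \<cdot> (inv\<^bsub>K\<^esub> a \<cdot> b)"
    using eq z h ab by (simp add: K.m_assoc)
  also have "\<dots> = b" using ab by (simp flip: K.m_assoc)
  finally have b: "b = a \<cdot> inv\<^bsub>K\<^esub> z \<cdot> \<theta> h z" ..
  have a: "a = a \<cdot> inv\<^bsub>K\<^esub> z \<cdot> z" using ab z by (simp add: K.m_assoc)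
  have "z \<noteq> \<one>\<^bsub>K\<^esub>" using a b ab h by auto
  then show ?thesis using a b z ab by (metis DiffI K.inv_closed K.m_closed singletonD)
qed

text \<open>The quotient \<open>(g \<cdot> z)\<inverse> \<cdot> (g \<cdot> \<theta> h z)\<close> forgets \<open>g\<close> and is the displacement of \<open>z\<close>.\<close>

lemma ordered_pair_decomposition_unique:
  assumes h: "h \<in> carrier H" "h \<noteq> \<one>\<^bsub>H\<^esub>"
    and c: "g \<in> carrier K" "z \<in> carrier K" "g' \<in> carrier K" "z' \<in> carrier K"
    and eq: "g \<cdot> z = g' \<cdot> z'" "g \<cdot> \<theta> h z = g' \<cdot> \<theta> h z'"
  shows "g = g' \<and> z = z'"
proof -
  have *: "inv\<^bsub>K\<^esub> (p \<cdot> w) \<cdot> (p \<cdot> \<theta> h w) = inv\<^bsub>K\<^esub> w \<cdot> \<theta> h w"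
    if "p \<in> carrier K" "w \<in> carrier K" for p w
  proof -
    have "inv\<^bsub>K\<^esub> p \<cdot> (p \<cdot> \<theta> h w) = \<theta> h w" using that h by (simp flip: K.m_assoc)
    then show ?thesis using that h by (simp add: K.inv_mult_group K.m_assoc)
  qed
  have "inv\<^bsub>K\<^esub> z \<cdot> \<theta> h z = inv\<^bsub>K\<^esub> z' \<cdot> \<theta> h z'"
    using *[of g z] *[of g' z'] c eq by simp
  then have "z = z'"
    using displacement_bij[OF h] c by (auto simp: bij_betw_def inj_on_def)
  then show ?thesis using eq c by simp
qed

text \<open>
  Applied to the cyclic group of \<open>\<phi>\<close>, this makes the general action of a semidirect product on its
  kernel available for the automorphism group in question.
\<close>

lemma frobenius_subgroup_generated: "frobenius K (subgroup_generated H S) \<theta>"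
proof -
  have sub: "carrier (subgroup_generated H S) \<subseteq> carrier H"
    by (rule H.carrier_subgroup_generated_subset)
  have "\<theta> \<in> hom (subgroup_generated H S) (AutoGroup K)"
    using action_hom sub by (auto simp: hom_def)
  then show ?thesis
    using sub finite_K finite_H fixed_point_free K.is_group H.group_subgroup_generated
    unfolding frobenius_def frobenius_axioms_def automorphism_action_def
      automorphism_action_axioms_def
    by (auto intro: finite_subset)
qed

end

section \<open>The blocks of the construction\<close>

locale frobenius_element = frobenius K H \<theta>
  for K :: "('a, 'm) monoid_scheme" and H :: "('h, 'n) monoid_scheme"
    and \<theta> :: "'h \<Rightarrow> 'a \<Rightarrow> 'a" +
  fixes \<phi> :: 'h
  assumes \<phi>: "\<phi> \<in> carrier H" and ord_ge_2: "2 \<le> H.ord \<phi>"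
begin

abbreviation k where "k \<equiv> H.ord \<phi>"

abbreviation \<sigma> :: "nat \<Rightarrow> 'a \<Rightarrow> 'a" where "\<sigma> i \<equiv> \<theta> (\<phi> [^]\<^bsub>H\<^esub> i)"

definition block :: "'a \<Rightarrow> 'a \<Rightarrow> 'a list set" where
  "block g x = cyc (map (\<lambda>i. g \<cdot> \<sigma> i x) [0..<k])"

lemma \<sigma>_add: "x \<in> carrier K \<Longrightarrow> \<sigma> i (\<sigma> j x) = \<sigma> (i + j) x"
  using \<phi> by (simp add: H.nat_pow_mult flip: action_comp)

lemma pow_mod: "\<phi> [^]\<^bsub>H\<^esub> (i mod k) = \<phi> [^]\<^bsub>H\<^esub> i"
proof -
  have "\<phi> [^]\<^bsub>H\<^esub> i = \<phi> [^]\<^bsub>H\<^esub> (k * (i div k) + i mod k)" by simp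
  also have "\<dots> = (\<phi> [^]\<^bsub>H\<^esub> k) [^]\<^bsub>H\<^esub> (i div k) \<otimes>\<^bsub>H\<^esub> \<phi> [^]\<^bsub>H\<^esub> (i mod k)"
    using \<phi> by (simp only: H.nat_pow_mult[symmetric] H.nat_pow_pow H.nat_pow_closed)
  finally show ?thesis using \<phi> by simp
qed

text \<open>
  Inverting a power of \<open>\<phi>\<close> by another natural power keeps all exponents in \<open>nat\<close>, as in the
  definition of the blocks.
\<close>

lemma \<sigma>_return: "x \<in> carrier K \<Longrightarrow> \<sigma> (i * (k - 1)) (\<sigma> i x) = x"
proof -
  assume x: "x \<in> carrier K"
  have "i * (k - 1) + i = i * k" using ord_ge_2 by (cases k) auto
  then have "\<phi> [^]\<^bsub>H\<^esub> (i * (k - 1) + i) = \<one>\<^bsub>H\<^esub>"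
    using H.pow_eq_id[OF \<phi>] by simp
  then show ?thesis using x by (simp add: \<sigma>_add)
qed

lemma \<sigma>_inj: "x \<in> nonunits \<Longrightarrow> i < k \<Longrightarrow> j < k \<Longrightarrow> \<sigma> i x = \<sigma> j x \<Longrightarrow> i = j"
  using semiregular[of "\<phi> [^]\<^bsub>H\<^esub> i" "\<phi> [^]\<^bsub>H\<^esub> j" x] H.ord_inj[OF \<phi>] \<phi> 
  by (auto simp: inj_on_def)

lemma pow_neq_one: "0 < t \<Longrightarrow> t < k \<Longrightarrow> \<phi> [^]\<^bsub>H\<^esub> t \<noteq> \<one>\<^bsub>H\<^esub>"
  using H.pow_eq_id[OF \<phi>] nat_dvd_not_less by auto

lemma points_of_block: "points_of (block g x) = {g \<cdot> \<sigma> i x | i. True}"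
proof -
  have "points_of (block g x) = (\<lambda>i. g \<cdot> \<sigma> i x) ` {..<k}"
    by (auto simp: block_def points_of_cyc)
  moreover have "g \<cdot> \<sigma> i x \<in> (\<lambda>i. g \<cdot> \<sigma> i x) ` {..<k}" for i
    using ord_ge_2 pow_mod[of i] by (intro image_eqI[of _ _ "i mod k"]) auto
  ultimately show ?thesis by auto
qed

text \<open>
  Letting \<open>i\<close> range over all naturals, instead of reducing modulo \<open>k\<close>, exposes the shape of the
  ordered pairs in the decomposition: \<open>\<sigma> i x\<close> is the element \<open>z\<close>.
\<close>

lemma t_apart_block:
  assumes "x \<in> carrier K"
  shows "t_apart t (block g x) a b \<longleftrightarrow> (\<exists>i. a = g \<cdot> \<sigma> i x \<and> b = g \<cdot> \<sigma> t (\<sigma> i x))"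
proof -
  have "t_apart t (block g x) a b \<longleftrightarrow>
      (\<exists>i<k. a = g \<cdot> \<sigma> i x \<and> b = g \<cdot> \<sigma> ((i + t) mod k) x)"
    unfolding block_def t_apart_cyc using ord_ge_2 by auto
  also have "\<dots> \<longleftrightarrow> (\<exists>i<k. a = g \<cdot> \<sigma> i x \<and> b = g \<cdot> \<sigma> t (\<sigma> i x))"
    by (simp only: pow_mod \<sigma>_add[OF assms] add.commute)
  also have "\<dots> \<longleftrightarrow> (\<exists>i. a = g \<cdot> \<sigma> i x \<and> b = g \<cdot> \<sigma> t (\<sigma> i x))"
  proof
    assume "\<exists>i. a = g \<cdot> \<sigma> i x \<and> b = g \<cdot> \<sigma> t (\<sigma> i x)"
    then obtain i where "a = g \<cdot> \<sigma> i x \<and> b = g \<cdot> \<sigma> t (\<sigma> i x)" by blast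
    then show "\<exists>i<k. a = g \<cdot> \<sigma> i x \<and> b = g \<cdot> \<sigma> t (\<sigma> i x)"
      using ord_ge_2 pow_mod[of i] by (intro exI[of _ "i mod k"]) auto
  qed blast
  finally show ?thesis .
qed

lemma block_shift:
  assumes x: "x \<in> carrier K"
  shows "block g (\<sigma> j x) = block g x"
proof -
  have "map (\<lambda>i. g \<cdot> \<sigma> i (\<sigma> j x)) [0..<k] = rotate j (map (\<lambda>i. g \<cdot> \<sigma> i x) [0..<k])"
    using ord_ge_2 by (intro nth_equalityI)
      (auto simp: nth_rotate \<sigma>_add[OF x] pow_mod add.commute)
  then show ?thesis unfolding block_def by (simp add: cyc_rotate)
qed

text \<open>
  A block contains the consecutive pair \<open>g \<cdot> x\<close>, \<open>g \<cdot> \<sigma> 1 x\<close>, and the decomposition of that pair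
  recovers \<open>g\<close> and \<open>x\<close>. Read in the other description of the block, the pair starts at some
  \<open>\<sigma> i x'\<close>.
\<close>

lemma block_inj:
  assumes g: "g \<in> carrier K" "g' \<in> carrier K" and x: "x \<in> nonunits" "x' \<in> nonunits"
    and eq: "block g x = block g' x'"
  shows "g = g' \<and> (\<exists>i. x = \<sigma> i x')"
proof -
  have "t_apart 1 (block g x) (g \<cdot> \<sigma> 0 x) (g \<cdot> \<sigma> 1 (\<sigma> 0 x))"
    using x by (subst t_apart_block) blast+
  then have "t_apart 1 (block g' x') (g \<cdot> x) (g \<cdot> \<sigma> 1 x)" using x eq by simp
  then obtain i where "g \<cdot> x = g' \<cdot> \<sigma> i x'" "g \<cdot> \<sigma> 1 x = g' \<cdot> \<sigma> 1 (\<sigma> i x')"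
    using x by (subst (asm) t_apart_block) auto
  then show ?thesis
    using ordered_pair_decomposition_unique[of "\<phi> [^]\<^bsub>H\<^esub> (1::nat)" g x g' "\<sigma> i x'"]
      pow_neq_one[of 1] ord_ge_2 g x \<phi> by auto
qed

lemma block_in_cyclic_subsets:
  assumes g: "g \<in> carrier K" and x: "x \<in> nonunits"
  shows "block g x \<in> cyclic_subsets k (carrier K)"
proof -
  have "inj_on (\<lambda>i. g \<cdot> \<sigma> i x) {0..<k}"
    using \<sigma>_inj[OF x] g x \<phi> by (auto simp: inj_on_def)
  then show ?thesis
    unfolding cyclic_subsets_def block_def mem_Collect_eq using g x \<phi>
    by (intro exI[of _ "map (\<lambda>i. g \<cdot> \<sigma> i x) [0..<k]"]) (auto simp: distinct_map)
qed

section \<open>Orbit representatives\<close>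

lemma orbit_cyclic: "orbit (cyclic_subgroup H \<phi>) \<theta> x = {\<sigma> i x | i. True}"
proof -
  have "carrier (cyclic_subgroup H \<phi>) = {\<phi> [^]\<^bsub>H\<^esub> i | i :: nat. True}"
    using H.generate_pow_on_finite_carrier[OF finite_H \<phi>] \<phi>
    by (simp add: carrier_subgroup_generated)
  then show ?thesis by (auto simp: orbit_def)
qed

text \<open>
  The representative that lies in the orbit of \<open>y\<close> is a power of \<open>\<phi>\<close> applied to \<open>y\<close>, and the power
  can be undone.
\<close>

lemma representative_exists:
  assumes R: "orbit_representatives K H \<theta> \<phi> R" and y: "y \<in> nonunits"
  obtains x i where "x \<in> R" "y = \<sigma> i x"
proof -
  obtain x where x: "x \<in> R" "x \<in> orbit (cyclic_subgroup H \<phi>) \<theta> y"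
    using R y unfolding orbit_representatives_def orbits_def by blast
  then obtain j where "x = \<sigma> j y" by (auto simp: orbit_cyclic)
  then have "y = \<sigma> (j * (k - 1)) x" using y \<sigma>_return[of y j] by simp
  then show thesis using x that by blast
qed

lemma representative_unique:
  assumes R: "orbit_representatives K H \<theta> \<phi> R" and x: "x \<in> R" "\<sigma> i x \<in> R"
  shows "\<sigma> i x = x"
proof -
  have xn: "x \<in> nonunits" using R x by (auto simp: orbit_representatives_def)
  then have "\<exists>!y. y \<in> R \<inter> orbit (cyclic_subgroup H \<phi>) \<theta> x"
    using R unfolding orbit_representatives_def orbits_def by blast
  moreover have "x = \<sigma> 0 x" using xn by simp
  then have "x \<in> orbit (cyclic_subgroup H \<phi>) \<theta> x" unfolding orbit_cyclic by blast
  ultimately show ?thesis using x unfolding orbit_cyclic by blast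
qed

text \<open>
  Every orbit is the orbit of each of its points, so different orbits are disjoint and one choice
  per orbit meets no orbit twice.
\<close>

lemma orbit_representatives_exist: "\<exists>R. orbit_representatives K H \<theta> \<phi> R"
proof -
  define \<O> where "\<O> = orbits (cyclic_subgroup H \<phi>) nonunits \<theta>"
  have orb: "S = {\<sigma> i y | i. True} \<and> S \<subseteq> nonunits" if S: "S \<in> \<O>" and y: "y \<in> S" for S y
  proof -
    obtain x where x: "x \<in> nonunits" and Sx: "S = {\<sigma> i x | i. True}"
      using S by (auto simp: \<O>_def orbits_def orbit_cyclic)
    obtain j where yj: "y = \<sigma> j x" using y Sx by blast
    have "\<sigma> i x = \<sigma> (i + j * (k - 1)) y" for i
    proof -
      have "\<sigma> (i + j * (k - 1)) y = \<sigma> i (\<sigma> (j * (k - 1)) (\<sigma> j x))"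
        using x \<phi> unfolding yj by (simp only: \<sigma>_add[symmetric] action_closed H.nat_pow_closed Diff_iff)
      then show ?thesis using x \<sigma>_return[of x j] by simp
    qed
    moreover have "\<sigma> i y = \<sigma> (i + j) x" for i using x by (simp add: yj \<sigma>_add)
    ultimately have "S = {\<sigma> i y | i. True}" unfolding Sx by blast
    moreover have "S \<subseteq> nonunits"
    proof
      fix z assume "z \<in> S"
      then obtain i where "z = \<sigma> i x" unfolding Sx by blast
      then show "z \<in> nonunits" using x \<phi> action_nonunits[of "\<phi> [^]\<^bsub>H\<^esub> i" x] by simp
    qed
    ultimately show ?thesis by blast
  qed
  define rep where "rep S = (SOME x. x \<in> S)" for S :: "'a set"
  have rep: "rep S \<in> S" if S: "S \<in> \<O>" for S
  proof -
    obtain x where "S = {\<sigma> i x | i. True}" using S unfolding \<O>_def orbits_def orbit_cyclic by blast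
    then have "\<sigma> 0 x \<in> S" by blast
    then show ?thesis unfolding rep_def by (rule someI)
  qed
  have "orbit_representatives K H \<theta> \<phi> (rep ` \<O>)"
    unfolding orbit_representatives_def \<O>_def[symmetric]
  proof (intro conjI ballI)
    show "rep ` \<O> \<subseteq> nonunits"
    proof (rule image_subsetI)
      fix S assume "S \<in> \<O>"
      then show "rep S \<in> nonunits" using orb rep subsetD by metis
    qed
    fix S assume S: "S \<in> \<O>"
    have "y = rep S" if y: "y \<in> rep ` \<O> \<inter> S" for y
    proof -
      obtain T where T: "T \<in> \<O>" "y = rep T" using y by blast
      then have "T = {\<sigma> i y | i. True}" using orb[OF T(1)] rep[OF T(1)] by metis
      moreover have "S = {\<sigma> i y | i. True}" using orb[OF S] y by (metis IntD2)
      ultimately show ?thesis using T(2) by (simp only:)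
    qed
    then show "\<exists>!x. x \<in> rep ` \<O> \<inter> S"
      using rep[OF S] S by (intro ex1I[of _ "rep S"] IntI imageI)
  qed
  then show ?thesis ..
qed

lemma constructed_blocks_eq_all:
  assumes R: "orbit_representatives K H \<theta> \<phi> R"
  shows "constructed_blocks K H \<theta> \<phi> R = {block g x | g x. g \<in> carrier K \<and> x \<in> nonunits}"
proof
  have "R \<subseteq> nonunits" using R by (simp add: orbit_representatives_def)
  then show "constructed_blocks K H \<theta> \<phi> R \<subseteq> {block g x | g x. g \<in> carrier K \<and> x \<in> nonunits}"
    unfolding constructed_blocks_def block_def by blast
  show "{block g x | g x. g \<in> carrier K \<and> x \<in> nonunits} \<subseteq> constructed_blocks K H \<theta> \<phi> R"
  proof
    fix c assume "c \<in> {block g x | g x. g \<in> carrier K \<and> x \<in> nonunits}"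
    then obtain g y where g: "g \<in> carrier K" and y: "y \<in> nonunits" and c: "c = block g y"
      by blast
    obtain x i where x: "x \<in> R" "y = \<sigma> i x" using representative_exists[OF R y] .
    then have "block g y = block g x"
      using \<open>R \<subseteq> nonunits\<close> block_shift[of x g i] by auto
    then show "c \<in> constructed_blocks K H \<theta> \<phi> R"
      using x g c unfolding constructed_blocks_def block_def by blast
  qed
qed

text \<open>
  The orbits are regular: each nonidentity element is \<open>\<sigma> i x\<close> for exactly one representative \<open>x\<close> and
  one exponent \<open>i < k\<close>.
\<close>

lemma card_representatives:
  assumes R: "orbit_representatives K H \<theta> \<phi> R"
  shows "card (carrier K) - 1 = card R * k"
proof -
  have sub: "R \<subseteq> nonunits" using R by (simp add: orbit_representatives_def)
  have "bij_betw (\<lambda>(x, i). \<sigma> i x) (R \<times> {..<k}) nonunits"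
    unfolding bij_betw_def
  proof
    show "inj_on (\<lambda>(x, i). \<sigma> i x) (R \<times> {..<k})"
    proof (rule inj_onI, clarsimp)
      fix x i x' i' assume x: "x \<in> R" "x' \<in> R" and i: "i < k" "i' < k" and eq: "\<sigma> i x = \<sigma> i' x'"
      have xn: "x \<in> nonunits" "x' \<in> nonunits" using x sub by auto
      have "x' = \<sigma> (i' * (k - 1) + i) x"
        using eq xn \<sigma>_return[of x' i'] by (simp add: \<sigma>_add flip: eq)
      then have "x = x'" using representative_unique[OF R, of x "i' * (k - 1) + i"] x by auto
      then show "x = x' \<and> i = i'" using \<sigma>_inj[OF xn(1) i] eq by auto
    qed
    have "\<sigma> i x \<in> nonunits" if "x \<in> R" for x i
      using that sub \<phi> action_nonunits by blast
    moreover have "y \<in> (\<lambda>(x, i). \<sigma> i x) ` (R \<times> {..<k})" if y: "y \<in> nonunits" for y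
    proof -
      obtain x i where "x \<in> R" "y = \<sigma> i x" using representative_exists[OF R y] .
      then show ?thesis using ord_ge_2 pow_mod[of i]
        by (intro image_eqI[of _ _ "(x, i mod k)"]) auto
    qed
    ultimately show "(\<lambda>(x, i). \<sigma> i x) ` (R \<times> {..<k}) = nonunits" by fast
  qed
  then have "card (R \<times> {..<k}) = card nonunits" by (rule bij_betw_same_card)
  then show ?thesis using finite_K by (simp add: card_cartesian_product)
qed

section \<open>Perfectness and resolvability\<close>

text \<open>
  A block with \<open>a\<close> and \<open>b\<close> in positions \<open>t\<close> apart is a decomposition of the pair \<open>(a, b)\<close> with
  respect to \<open>\<sigma> t\<close>. The decomposition is unique, up to the starting point of the orbit, which does
  not change the block.
\<close>

lemma construction_each_pair_once:
  assumes R: "orbit_representatives K H \<theta> \<phi> R" and t: "0 < t" "t < k"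
  shows "each_pair_once_apart t (carrier K) (constructed_blocks K H \<theta> \<phi> R)"
  unfolding each_pair_once_apart_def constructed_blocks_eq_all[OF R]
proof (intro ballI impI)
  fix a b assume ab: "a \<in> carrier K" "b \<in> carrier K" "a \<noteq> b"
  have pt: "\<phi> [^]\<^bsub>H\<^esub> t \<in> carrier H" "\<phi> [^]\<^bsub>H\<^esub> t \<noteq> \<one>\<^bsub>H\<^esub>" using \<phi> pow_neq_one[OF t] by auto
  obtain g z where g: "g \<in> carrier K" and z: "z \<in> nonunits" and az: "a = g \<cdot> z" "b = g \<cdot> \<sigma> t z"
    using ordered_pair_decomposition[OF pt ab] by blast
  show "\<exists>!c. c \<in> {block g x | g x. g \<in> carrier K \<and> x \<in> nonunits} \<and> t_apart t c a b"
  proof (rule ex1I[of _ "block g z"], intro conjI)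
    have "\<exists>i. a = g \<cdot> \<sigma> i z \<and> b = g \<cdot> \<sigma> t (\<sigma> i z)"
      using az z by (intro exI[of _ 0]) auto
    then show "t_apart t (block g z) a b" using z by (simp add: t_apart_block)
    show "block g z \<in> {block g x | g x. g \<in> carrier K \<and> x \<in> nonunits}" using g z by blast
    fix c assume c: "c \<in> {block g x | g x. g \<in> carrier K \<and> x \<in> nonunits} \<and> t_apart t c a b"
    then obtain g' x where g': "g' \<in> carrier K" and x: "x \<in> nonunits" and cx: "c = block g' x"
      by blast
    then obtain i where i: "a = g' \<cdot> \<sigma> i x" "b = g' \<cdot> \<sigma> t (\<sigma> i x)"
      using c t_apart_block[of x] by auto
    have "g' = g \<and> \<sigma> i x = z"
      using x z \<phi> i az by (intro ordered_pair_decomposition_unique[OF pt g' _ g]) auto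
    then show "c = block g z" using cx block_shift[of x g' i] x by auto
  qed
qed

lemma construction_mendelsohn:
  assumes R: "orbit_representatives K H \<theta> \<phi> R" and v: "k \<le> card (carrier K)"
  shows "mendelsohn_design (card (carrier K)) k (carrier K) (constructed_blocks K H \<theta> \<phi> R)"
  unfolding mendelsohn_design_def
  using ord_ge_2 v finite_K construction_each_pair_once[OF R, of 1] block_in_cyclic_subsets
  by (auto simp: constructed_blocks_eq_all[OF R])

text \<open>Blocks with a common \<open>g\<close> are disjoint because distinct orbits are.\<close>

lemma parallel_class:
  assumes R: "orbit_representatives K H \<theta> \<phi> R" and g: "g \<in> carrier K"
  shows "pairwise_disjoint_blocks (block g ` R)"
proof -
  have sub: "R \<subseteq> nonunits" using R by (simp add: orbit_representatives_def)
  have "x = x'" if x: "x \<in> R" "x' \<in> R" and p: "p \<in> points_of (block g x)" "p \<in> points_of (block g x')"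
    for x x' p
  proof -
    obtain i j where "p = g \<cdot> \<sigma> i x" "p = g \<cdot> \<sigma> j x'" using p unfolding points_of_block by blast
    then have eq: "\<sigma> i x = \<sigma> j x'" using x sub g \<phi> by (auto simp: subset_iff)
    have "x' = \<sigma> (j * (k - 1)) (\<sigma> j x')" using x sub \<sigma>_return[of x' j] by auto
    also have "\<dots> = \<sigma> (j * (k - 1) + i) x" using x sub by (auto simp: \<sigma>_add simp flip: eq)
    finally show ?thesis using representative_unique[OF R] x by metis
  qed
  then show ?thesis unfolding pairwise_disjoint_blocks_def pairwise_def disjnt_iff by blast
qed

text \<open>
  There is one class for each \<open>g \<in> K\<close>. A block determines \<open>g\<close>, so the classes are disjoint and
  there are \<open>v\<close> of them; each has as many blocks as there are representatives, namely
  \<open>(v - 1) div k\<close>.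
\<close>

lemma construction_resolvable:
  assumes R: "orbit_representatives K H \<theta> \<phi> R" and v: "3 \<le> card (carrier K)"
    and mod: "card (carrier K) mod k = 1"
  shows "resolvable (card (carrier K)) k (constructed_blocks K H \<theta> \<phi> R)"
proof -
  let ?P = "(\<lambda>g. block g ` R) ` carrier K"
  have sub: "R \<subseteq> nonunits" using R by (simp add: orbit_representatives_def)
  have ne: "R \<noteq> {}" using card_representatives[OF R] v by auto
  have same: "g = g'" if "g \<in> carrier K" "g' \<in> carrier K" "block g x = block g' x'" "x \<in> R" "x' \<in> R"
    for g g' x x' using block_inj[of g g' x x'] that sub by blast
  have inj: "inj_on (block g) R" if g: "g \<in> carrier K" for g
  proof (rule inj_onI)
    fix x x' assume x: "x \<in> R" "x' \<in> R" "block g x = block g x'"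
    then obtain i where "x = \<sigma> i x'" using block_inj[of g g x x'] g sub by blast
    then show "x = x'" using representative_unique[OF R] x by metis
  qed
  have "partition_on (constructed_blocks K H \<theta> \<phi> R) ?P"
  proof (rule partition_onI)
    show "\<Union> ?P = constructed_blocks K H \<theta> \<phi> R"
      unfolding constructed_blocks_def block_def by blast
    show "disjnt p q" if "p \<in> ?P" "q \<in> ?P" "p \<noteq> q" for p q
      using that same unfolding disjnt_iff by blast
    show "{} \<notin> ?P" using ne by auto
  qed
  moreover have "card ?P = card (carrier K)"
  proof (rule card_image, rule inj_onI)
    fix g g' assume g: "g \<in> carrier K" "g' \<in> carrier K" and eq: "block g ` R = block g' ` R"
    obtain x where x: "x \<in> R" using ne by blast
    then obtain x' where "x' \<in> R" "block g x = block g' x'" using eq by blast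
    then show "g = g'" using same g x by blast
  qed
  moreover have "card p = (card (carrier K) - 1) div k \<and> pairwise_disjoint_blocks p"
    if p: "p \<in> ?P" for p
    using p parallel_class[OF R] card_image[OF inj] card_representatives[OF R] ord_ge_2 by auto
  ultimately show ?thesis unfolding resolvable_def using mod by blast
qed

section \<open>Automorphisms\<close>

text \<open>
  Since \<open>h\<close> commutes with \<open>\<phi>\<close>, the map \<open>\<theta> h\<close> carries \<open>\<sigma> i x\<close> to \<open>\<sigma> i (\<theta> h x)\<close> and thus orbits
  to orbits.
\<close>

lemma map_block_kernel_action:
  assumes g: "g \<in> carrier K" and h: "h \<in> carrier H" and comm: "h \<otimes>\<^bsub>H\<^esub> \<phi> = \<phi> \<otimes>\<^bsub>H\<^esub> h"
    and a: "a \<in> carrier K" and x: "x \<in> carrier K"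
  shows "map_block (kernel_action K \<theta> (g, h)) (block a x) = block (g \<cdot> \<theta> h a) (\<theta> h x)"
proof -
  have comm_pow: "h \<otimes>\<^bsub>H\<^esub> \<phi> [^]\<^bsub>H\<^esub> i = \<phi> [^]\<^bsub>H\<^esub> i \<otimes>\<^bsub>H\<^esub> h" for i :: nat
    using comm h \<phi>
    by (induction i) (auto simp: H.m_assoc, metis H.m_assoc H.nat_pow_closed)
  have "kernel_action K \<theta> (g, h) (a \<cdot> \<sigma> i x) = g \<cdot> \<theta> h a \<cdot> \<sigma> i (\<theta> h x)" for i
    using g h a x \<phi> action_comp[of h "\<phi> [^]\<^bsub>H\<^esub> i" x] action_comp[of "\<phi> [^]\<^bsub>H\<^esub> i" h x]
    by (simp add: kernel_action_def action_mult K.m_assoc comm_pow)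
  then show ?thesis unfolding block_def map_block_cyc by (simp add: comp_def)
qed

lemma blocks_invariant:
  assumes R: "orbit_representatives K H \<theta> \<phi> R"
    and g: "g \<in> carrier K" and h: "h \<in> carrier H" and comm: "h \<otimes>\<^bsub>H\<^esub> \<phi> = \<phi> \<otimes>\<^bsub>H\<^esub> h"
  shows "map_block (kernel_action K \<theta> (g, h)) ` constructed_blocks K H \<theta> \<phi> R
    = constructed_blocks K H \<theta> \<phi> R" (is "?f ` ?B = ?B")
proof
  show "?f ` ?B \<subseteq> ?B"
  proof
    fix c assume "c \<in> ?f ` ?B"
    then obtain a x where a: "a \<in> carrier K" and x: "x \<in> nonunits" and c: "c = ?f (block a x)"
      unfolding constructed_blocks_eq_all[OF R] by blast
    have "c = block (g \<cdot> \<theta> h a) (\<theta> h x)"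
      using map_block_kernel_action[OF g h comm a, of x] x c by simp
    moreover have "\<theta> h x \<in> nonunits" using h x by (rule action_nonunits)
    moreover have "g \<cdot> \<theta> h a \<in> carrier K" using g h a by simp
    ultimately show "c \<in> ?B" unfolding constructed_blocks_eq_all[OF R] by blast
  qed
  show "?B \<subseteq> ?f ` ?B"
  proof
    fix c assume "c \<in> ?B"
    then obtain b y where b: "b \<in> carrier K" and y: "y \<in> nonunits" and c: "c = block b y"
      unfolding constructed_blocks_eq_all[OF R] by blast
    obtain a where a: "a \<in> carrier K" "\<theta> h a = inv\<^bsub>K\<^esub> g \<cdot> b"
      using action_bij[OF h] g b unfolding bij_betw_def by (metis K.inv_closed K.m_closed imageE)
    obtain x where x: "x \<in> carrier K" "\<theta> h x = y"
      using action_bij[OF h] y unfolding bij_betw_def by (metis DiffD1 imageE)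
    have "x \<noteq> \<one>\<^bsub>K\<^esub>" using x y h by auto
    moreover have "g \<cdot> \<theta> h a = b" using a g b by (simp flip: K.m_assoc)
    ultimately have "c = ?f (block a x)" "block a x \<in> ?B"
      using map_block_kernel_action[OF g h comm, of a x] a x c
      unfolding constructed_blocks_eq_all[OF R] by auto
    then show "c \<in> ?f ` ?B" by blast
  qed
qed

lemma admits_semidirect:
  assumes R: "orbit_representatives K H \<theta> \<phi> R"
  shows "admits_automorphisms (semidirect_product K (cyclic_subgroup H \<phi>) \<theta>)
    (kernel_action K \<theta>) (carrier K) (constructed_blocks K H \<theta> \<phi> R)"
proof -
  interpret C: frobenius K "cyclic_subgroup H \<phi>" \<theta> by (rule frobenius_subgroup_generated)
  have "h \<in> carrier H \<and> h \<otimes>\<^bsub>H\<^esub> \<phi> = \<phi> \<otimes>\<^bsub>H\<^esub> h" if "h \<in> carrier (cyclic_subgroup H \<phi>)" for h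
  proof -
    have "h \<in> generate H {\<phi>}" using that \<phi> by (simp add: carrier_subgroup_generated)
    then obtain i :: nat where "h = \<phi> [^]\<^bsub>H\<^esub> i"
      using H.generate_pow_on_finite_carrier[OF finite_H \<phi>] by auto
    then show ?thesis using \<phi> H.nat_pow_Suc H.nat_pow_Suc2 by (metis H.nat_pow_closed)
  qed
  then show ?thesis
    unfolding admits_automorphisms_def using C.kernel_action_group_action blocks_invariant[OF R]
    by (auto simp: semidirect_product_def)
qed

text \<open>
  The points are already the elements of \<open>K\<close>, so the identity serves as identification; the left
  regular representation is the kernel action restricted to \<open>K\<close>.
\<close>

lemma construction_based_on:
  assumes R: "orbit_representatives K H \<theta> \<phi> R"
  shows "based_on K (carrier K) (constructed_blocks K H \<theta> \<phi> R)"
proof -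
  let ?B = "constructed_blocks K H \<theta> \<phi> R"
  have eq: "left_regular K g = kernel_action K \<theta> (g, \<one>\<^bsub>H\<^esub>)" for g
    by (auto simp: left_regular_def kernel_action_def fun_eq_iff)
  have "left_regular K (g \<cdot> g')
      = left_regular K g \<otimes>\<^bsub>BijGroup (carrier K)\<^esub> left_regular K g'"
    if "g \<in> carrier K" "g' \<in> carrier K" for g g'
  proof -
    have "left_regular K (g \<cdot> g') = compose (carrier K) (left_regular K g) (left_regular K g')"
      using that by (auto simp: left_regular_def compose_def fun_eq_iff K.m_assoc)
    then show ?thesis
      using kernel_action_bij that by (simp add: eq BijGroup_def)
  qed
  then have "group_action K (carrier K) (left_regular K)"
    unfolding group_action_def group_hom_def group_hom_axioms_def
    using kernel_action_bij group_BijGroup[of "carrier K"]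
    by (auto simp: hom_def BijGroup_def eq K.is_group)
  moreover have "map_block (left_regular K g) ` ?B = ?B" if "g \<in> carrier K" for g
    unfolding eq using that \<phi> by (intro blocks_invariant[OF R]) auto
  moreover have "map_block id ` ?B = ?B" by (simp add: map_block_def)
  ultimately show ?thesis
    unfolding based_on_def admits_automorphisms_def
    by (intro exI[of _ id]) simp
qed

end

section \<open>Conjugate elements\<close>

text \<open>
  The relation \<open>h \<psi> = \<psi>' h\<close> passes to powers, so \<open>\<theta> h\<close> carries \<open>\<psi>\<close>-orbits to \<open>\<psi>'\<close>-orbits. The image
  of a representative need not be a chosen representative for \<open>\<psi>'\<close>, which is harmless because the
  block sets are independent of the choice.
\<close>

lemma (in frobenius) conjugate_blocks:
  assumes el: "frobenius_element K H \<theta> \<psi>" "frobenius_element K H \<theta> \<psi>'"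
    and h: "h \<in> carrier H" and conj: "\<psi>' = h \<otimes>\<^bsub>H\<^esub> \<psi> \<otimes>\<^bsub>H\<^esub> inv\<^bsub>H\<^esub> h"
    and ord: "H.ord \<psi> = H.ord \<psi>'"
    and R: "orbit_representatives K H \<theta> \<psi> R" "orbit_representatives K H \<theta> \<psi>' R'"
  shows "map_block (\<theta> h) ` constructed_blocks K H \<theta> \<psi> R = constructed_blocks K H \<theta> \<psi>' R'"
proof -
  interpret A: frobenius_element K H \<theta> \<psi> by fact
  interpret B: frobenius_element K H \<theta> \<psi>' by fact
  have \<psi>: "\<psi> \<in> carrier H" by (rule A.\<phi>)
  have step: "h \<otimes>\<^bsub>H\<^esub> \<psi> = \<psi>' \<otimes>\<^bsub>H\<^esub> h" using h \<psi> by (simp add: conj H.m_assoc)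
  have pow: "h \<otimes>\<^bsub>H\<^esub> \<psi> [^]\<^bsub>H\<^esub> i = \<psi>' [^]\<^bsub>H\<^esub> i \<otimes>\<^bsub>H\<^esub> h" for i :: nat
  proof (induction i)
    case (Suc i)
    have "h \<otimes>\<^bsub>H\<^esub> \<psi> [^]\<^bsub>H\<^esub> Suc i = h \<otimes>\<^bsub>H\<^esub> \<psi> [^]\<^bsub>H\<^esub> i \<otimes>\<^bsub>H\<^esub> \<psi>"
      using h \<psi> by (simp add: H.m_assoc)
    also have "\<dots> = \<psi>' [^]\<^bsub>H\<^esub> i \<otimes>\<^bsub>H\<^esub> (h \<otimes>\<^bsub>H\<^esub> \<psi>)"
      using Suc h \<psi> B.\<phi> by (simp add: H.m_assoc)
    also have "\<dots> = \<psi>' [^]\<^bsub>H\<^esub> Suc i \<otimes>\<^bsub>H\<^esub> h"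
      using step h B.\<phi> by (simp add: H.m_assoc)
    finally show ?case .
  qed (use h in simp)
  have image: "map_block (\<theta> h) (A.block g x) = B.block (\<theta> h g) (\<theta> h x)"
    if "g \<in> carrier K" "x \<in> carrier K" for g x
  proof -
    have "\<theta> h (g \<cdot> \<theta> (\<psi> [^]\<^bsub>H\<^esub> i) x) = \<theta> h g \<cdot> \<theta> (\<psi>' [^]\<^bsub>H\<^esub> i) (\<theta> h x)" for i :: nat
      using that h \<psi> B.\<phi> by (simp add: action_mult pow flip: action_comp)
    then show ?thesis
      unfolding A.block_def B.block_def map_block_cyc by (simp add: comp_def ord)
  qed
  show ?thesis
    unfolding A.constructed_blocks_eq_all[OF R(1)] B.constructed_blocks_eq_all[OF R(2)]
  proof (intro equalityI subsetI)
    fix c assume "c \<in> map_block (\<theta> h) ` {A.block g x | g x. g \<in> carrier K \<and> x \<in> nonunits}"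
    then obtain g x where "g \<in> carrier K" "x \<in> nonunits" "c = B.block (\<theta> h g) (\<theta> h x)"
      using image by auto
    moreover from this have "\<theta> h x \<in> nonunits" "\<theta> h g \<in> carrier K"
      using h action_nonunits[OF h, of x] by auto
    ultimately show "c \<in> {B.block g x | g x. g \<in> carrier K \<and> x \<in> nonunits}" by blast
  next
    fix c assume "c \<in> {B.block g x | g x. g \<in> carrier K \<and> x \<in> nonunits}"
    then obtain b y where b: "b \<in> carrier K" and y: "y \<in> nonunits" and c: "c = B.block b y"
      by blast
    obtain g where g: "g \<in> carrier K" "\<theta> h g = b"
      using action_bij[OF h] b unfolding bij_betw_def by (metis imageE)
    obtain x where x: "x \<in> carrier K" "\<theta> h x = y"
      using action_bij[OF h] y unfolding bij_betw_def by (metis DiffD1 imageE)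
    have "x \<in> nonunits" using x y h by auto
    then show "c \<in> map_block (\<theta> h) ` {A.block g x | g x. g \<in> carrier K \<and> x \<in> nonunits}"
      using image[of g x] g x c by blast
  qed
qed

section \<open>The designs of a Frobenius group\<close>

theorem theorem3p1:
  fixes v k :: nat
    and K :: "('a, 'm) monoid_scheme" and H :: "('h, 'n) monoid_scheme"
    and \<theta> :: "'h \<Rightarrow> 'a \<Rightarrow> 'a" and \<phi> :: 'h
  assumes "v \<ge> 3" and "k \<ge> 2" and "v mod k = 1"
    and "frobenius_group K H \<theta>" and "card (carrier K) = v"
    and "\<phi> \<in> carrier H" and "group.ord H \<phi> = k"
  shows "(\<exists>R. orbit_representatives K H \<theta> \<phi> R) \<and>
    (\<forall>R. orbit_representatives K H \<theta> \<phi> R \<longrightarrow>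
      (let X = carrier K; B = constructed_blocks K H \<theta> \<phi> R in
        RMD v k X B \<and>
        fold_perfect (smallest_prime_factor k - 1) X B \<and>
        based_on K X B \<and>
        admits_automorphisms (semidirect_product K (cyclic_subgroup H \<phi>) \<theta>)
          (kernel_action K \<theta>) X B \<and>
        (prime k \<longrightarrow> RPMD v k X B))) \<and>
    (\<forall>\<psi>\<in>carrier H. \<forall>\<psi>'\<in>carrier H.
      group.ord H \<psi> = k \<and> group.ord H \<psi>' = k \<and> conjugate_in H \<psi> \<psi>' \<longrightarrow>
      (\<forall>R R'. orbit_representatives K H \<theta> \<psi> R \<and> orbit_representatives K H \<theta> \<psi>' R' \<longrightarrow>
        MD_isomorphic (carrier K) (constructed_blocks K H \<theta> \<psi> R)
          (carrier K) (constructed_blocks K H \<theta> \<psi>' R')))"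
proof -
  interpret frobenius K H \<theta> using assms(4) by (simp add: frobenius_iff)
  have element: "frobenius_element K H \<theta> \<psi>" if "\<psi> \<in> carrier H" "H.ord \<psi> = k" for \<psi>
    using that assms(2) by unfold_locales auto
  interpret E: frobenius_element K H \<theta> \<phi> using element assms(6,7) .
  have "k \<le> v" using assms(1-3) by (cases "v < k") auto
  have design: "RMD v k (carrier K) (constructed_blocks K H \<theta> \<phi> R)"
    if "orbit_representatives K H \<theta> \<phi> R" for R
    using E.construction_mendelsohn[OF that] E.construction_resolvable[OF that] assms \<open>k \<le> v\<close> by (simp add: RMD_def)
  have perfect: "fold_perfect l (carrier K) (constructed_blocks K H \<theta> \<phi> R)"
    if "orbit_representatives K H \<theta> \<phi> R" "l < k" for l R
    using E.construction_each_pair_once[OF that(1)] that(2) assms(7) by (auto simp: fold_perfect_def)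
  have "smallest_prime_factor k \<in> prime_factors k"
    unfolding smallest_prime_factor_def using assms(2)
    by (intro Min_in) (auto simp: prime_factorization_empty_iff)
  then have "smallest_prime_factor k - 1 < k"
    using assms(2) by (auto simp: in_prime_factors_iff dest!: dvd_imp_le)
  moreover have "MD_isomorphic (carrier K) (constructed_blocks K H \<theta> \<psi> R)
      (carrier K) (constructed_blocks K H \<theta> \<psi>' R')"
    if "\<psi> \<in> carrier H" "\<psi>' \<in> carrier H" "H.ord \<psi> = k" "H.ord \<psi>' = k" "conjugate_in H \<psi> \<psi>'"
      "orbit_representatives K H \<theta> \<psi> R" "orbit_representatives K H \<theta> \<psi>' R'" for \<psi> \<psi>' R R'
    using that conjugate_blocks[OF element element, of \<psi> \<psi>'] action_bij
    unfolding conjugate_in_def MD_isomorphic_def by metis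
  ultimately show ?thesis
    using E.orbit_representatives_exist design perfect E.construction_based_on
      E.admits_semidirect assms(2)
    by (auto simp: Let_def RPMD_def)
qed

end
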